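(* Let $B_w$ be a mixing weighted backward shift on $\ell^1$, considered as a Banach sequence algebra under the Cauchy product. Then the set $HC(B_w)$ of hypercyclic vectors for $B_w$ is algebrable. This applies, in particular, to the Rolewicz operators $\lambda B$ with $\lambda\in\mathbb{C}$, $|\lambda|>1$.
   Context: $\ell^1$ is the Banach space of absolutely summable complex sequences $x=(x_n)_{n\ge0}$ with its usual norm. The Cauchy product is $x\ast y=(z_n)_n$ with $z_n=\sum_{k=0}^nx_ky_{n-k}$. A weight is a sequence $w=(w_n)_{n\ge0}$ of non-zero complex numbers, with the convention $w_0=1$. The weighted backward shift is $B_w(x_0,x_1,x_2,\dots)=(w_1x_1,w_2x_2,w_3x_3,\dots)$; saying that it is a weighted backward shift on $X=\ell^1$ means that it maps $X$ into $X$ (it is then a continuous linear operator on $X$). $B$ is the unweighted shift $B(x_0,x_1,\dots)=(x_1,x_2,\dots)$. An operator $T$ on $X$ is mixing if for any non-empty open $U,V\subset X$ the set $\{n\ge0:T^n(U)\cap V\ne\varnothing\}$ is co-finite. $HC(T)=\{x\in X:\{x,Tx,T^2x,\dots\}\text{ is dense in }X\}$. $HC(T)$ is algebrable if $HC(T)\cup\{0\}$ contains a subalgebra of $X$ (here for the Cauchy product) that is infinitely but not finitely generated. Algebras are not required to be unital; the algebra generated by a set is the smallest subalgebra containing it (the linear span of all finite products of at least one element of the set), and an algebra is finitely generated if it is generated by a finite subset. *)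

theory Defs
  imports "HOL-Analysis.Analysis"
begin

section \<open>The Banach algebra of absolutely summable complex sequences\<close>

typedef ell1 = "{x :: nat \<Rightarrow> complex. summable (\<lambda>n. norm (x n))}"
  morphisms seq Abs_ell1
  by (intro exI[of _ "\<lambda>_. 0"]) simp

setup_lifting type_definition_ell1

lemma ell1_eqI: "(\<And>n. seq x n = seq y n) \<Longrightarrow> x = y"
  by (metis ext seq_inject)

lemma summable_norm_seq [simp]: "summable (\<lambda>n. norm (seq x n))"
  using seq by auto

lemma summable_norm_Cauchy_product:
  fixes x y :: "nat \<Rightarrow> complex"
  assumes "summable (\<lambda>n. norm (x n))" "summable (\<lambda>n. norm (y n))"
  shows "summable (\<lambda>n. norm (\<Sum>k\<le>n. x k * y (n - k)))"
proof (rule summable_comparison_test')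
  show "summable (\<lambda>n. \<Sum>k\<le>n. norm (x k) * norm (y (n - k)))"
    using assms by (intro summable_Cauchy_product) auto
  show "norm (norm (\<Sum>k\<le>n. x k * y (n - k))) \<le> (\<Sum>k\<le>n. norm (x k) * norm (y (n - k)))"
    if "n \<ge> 0" for n
    using norm_sum[of "\<lambda>k. x k * y (n - k)" "{..n}"] by (simp add: norm_mult)
qed

instantiation ell1 :: comm_ring_1
begin

lift_definition zero_ell1 :: ell1 is "\<lambda>_. 0" by simp

lift_definition one_ell1 :: ell1 is "\<lambda>n. if n = 0 then 1 else 0"
  by (rule summable_finite[of "{0}"]) auto

lift_definition plus_ell1 :: "ell1 \<Rightarrow> ell1 \<Rightarrow> ell1" is "\<lambda>x y n. x n + y n"
proof -
  fix x y :: "nat \<Rightarrow> complex"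
  assume "summable (\<lambda>n. norm (x n))" "summable (\<lambda>n. norm (y n))"
  then have "summable (\<lambda>n. norm (x n) + norm (y n))" by (rule summable_add)
  then show "summable (\<lambda>n. norm (x n + y n))"
    by (rule summable_comparison_test') (simp add: norm_triangle_ineq)
qed

lift_definition uminus_ell1 :: "ell1 \<Rightarrow> ell1" is "\<lambda>x n. - x n" by simp

lift_definition minus_ell1 :: "ell1 \<Rightarrow> ell1 \<Rightarrow> ell1" is "\<lambda>x y n. x n - y n"
proof -
  fix x y :: "nat \<Rightarrow> complex"
  assume "summable (\<lambda>n. norm (x n))" "summable (\<lambda>n. norm (y n))"
  then have "summable (\<lambda>n. norm (x n) + norm (y n))" by (rule summable_add)
  then show "summable (\<lambda>n. norm (x n - y n))"
    by (rule summable_comparison_test') (simp add: norm_triangle_ineq4)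
qed

lift_definition times_ell1 :: "ell1 \<Rightarrow> ell1 \<Rightarrow> ell1" is "\<lambda>x y n. \<Sum>k\<le>n. x k * y (n - k)"
  by (rule summable_norm_Cauchy_product)

instance
proof
  have fps: "Abs_fps (seq (x * y)) = Abs_fps (seq x) * Abs_fps (seq y)" for x y
    by (rule fps_ext) (simp add: times_ell1.rep_eq fps_mult_nth atMost_atLeast0)
  have inj: "x = y" if "Abs_fps (seq x) = Abs_fps (seq y)" for x y
    by (rule ell1_eqI) (metis that fps_nth_Abs_fps)
  have add: "Abs_fps (seq (x + y)) = Abs_fps (seq x) + Abs_fps (seq y)" for x y
    by (rule fps_ext) (simp add: plus_ell1.rep_eq)
  have one: "Abs_fps (seq 1) = 1"
    by (rule fps_ext) (simp add: one_ell1.rep_eq)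
  fix a b c :: ell1
  show "a * b * c = a * (b * c)" by (rule inj) (simp add: fps mult.assoc)
  show "a * b = b * a" by (rule inj) (simp add: fps mult.commute)
  show "1 * a = a" by (rule inj) (simp add: fps one)
  show "(a + b) * c = a * c + b * c" by (rule inj) (simp add: fps add distrib_right)
  show "0 \<noteq> (1 :: ell1)"
    by (metis one_ell1.rep_eq zero_ell1.rep_eq zero_neq_one)
qed (transfer; simp add: fun_eq_iff; fail)+

end

lift_definition scaleC :: "complex \<Rightarrow> ell1 \<Rightarrow> ell1" (infixr \<open>*\<^sub>C\<close> 75)
  is "\<lambda>c x n. c * x n"
  by (simp add: norm_mult summable_mult)

instantiation ell1 :: real_normed_algebra_1
begin

lift_definition scaleR_ell1 :: "real \<Rightarrow> ell1 \<Rightarrow> ell1" is "\<lambda>r x n. r *\<^sub>R x n"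
  by (simp add: summable_mult)

lift_definition norm_ell1 :: "ell1 \<Rightarrow> real" is "\<lambda>x. \<Sum>n. norm (x n)" .

definition "dist_ell1 (x::ell1) y = norm (x - y)"
definition "sgn_ell1 (x::ell1) = inverse (norm x) *\<^sub>R x"
definition "(uniformity :: (ell1 \<times> ell1) filter)
  = (INF e\<in>{0<..}. principal {(x, y). dist x y < e})"
definition "open_ell1 (U :: ell1 set)
  = (\<forall>x\<in>U. eventually (\<lambda>(x', y). x' = x \<longrightarrow> y \<in> U) uniformity)"

instance
proof
  fix x y :: ell1 and a b :: real
  show "dist x y = norm (x - y)" by (simp add: dist_ell1_def)
  show "sgn x = inverse (norm x) *\<^sub>R x" by (simp add: sgn_ell1_def)
  show "(uniformity :: (ell1 \<times> ell1) filter)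
    = (INF e\<in>{0<..}. principal {(x, y). dist x y < e})" by (rule uniformity_ell1_def)
  show "open U = (\<forall>x\<in>U. eventually (\<lambda>(x', y). x' = x \<longrightarrow> y \<in> U) uniformity)"
    for U :: "ell1 set" by (rule open_ell1_def)
  show "a *\<^sub>R (x + y) = a *\<^sub>R x + a *\<^sub>R y" by transfer (simp add: scaleR_right_distrib)
  show "(a + b) *\<^sub>R x = a *\<^sub>R x + b *\<^sub>R x" by transfer (simp add: scaleR_left_distrib)
  show "a *\<^sub>R b *\<^sub>R x = (a * b) *\<^sub>R x" by transfer simp
  show "1 *\<^sub>R x = x" by transfer simp
  show "a *\<^sub>R x * y = a *\<^sub>R (x * y)" by transfer (simp add: scaleR_sum_right)
  show "x * a *\<^sub>R y = a *\<^sub>R (x * y)" by transfer (simp add: scaleR_sum_right)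
  show "norm x = 0 \<longleftrightarrow> x = 0"
    by transfer (auto simp: suminf_eq_zero_iff)
  show "norm (x + y) \<le> norm x + norm y"
  proof -
    have "(\<Sum>n. norm (seq (x + y) n)) \<le> (\<Sum>n. norm (seq x n) + norm (seq y n))"
      by (intro suminf_le summable_add)
        (auto simp: norm_triangle_ineq plus_ell1.rep_eq
          intro: summable_norm_seq[of "x + y", unfolded plus_ell1.rep_eq])
    then show ?thesis by (simp add: norm_ell1.rep_eq suminf_add)
  qed
  show "norm (a *\<^sub>R x) = \<bar>a\<bar> * norm x"
    by transfer (simp add: suminf_mult)
  show "norm (x * y) \<le> norm x * norm y"
  proof -
    have "(\<Sum>n. norm (seq (x * y) n)) \<le> (\<Sum>n. \<Sum>k\<le>n. norm (seq x k) * norm (seq y (n - k)))"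
    proof (rule suminf_le)
      show "norm (seq (x * y) n) \<le> (\<Sum>k\<le>n. norm (seq x k) * norm (seq y (n - k)))" for n
        using norm_sum[of "\<lambda>k. seq x k * seq y (n - k)" "{..n}"]
        by (simp add: norm_mult times_ell1.rep_eq)
      show "summable (\<lambda>n. \<Sum>k\<le>n. norm (seq x k) * norm (seq y (n - k)))"
        by (intro summable_Cauchy_product) auto
    qed simp
    also have "\<dots> = norm x * norm y"
      by (simp add: norm_ell1.rep_eq Cauchy_product)
    finally show ?thesis by (simp add: norm_ell1.rep_eq)
  qed
  show "norm (1 :: ell1) = 1"
    by transfer (subst suminf_finite[of "{0}"], auto)
qed

end

instance ell1 :: banach
proof
  fix X :: "nat \<Rightarrow> ell1"
  assume C: "Cauchy X"
  have le_norm: "(\<Sum>n<N. norm (seq x n)) \<le> norm x" for x N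
    unfolding norm_ell1.rep_eq by (rule sum_le_suminf) auto
  have coord: "norm (seq x n) \<le> norm x" for x n
    using le_norm[of x "Suc n"] sum_nonneg[of "{..<n}" "\<lambda>n. norm (seq x n)"] by simp
  have "Cauchy (\<lambda>m. seq (X m) n)" for n
  proof (rule CauchyI)
    fix e :: real assume "e > 0"
    then obtain M where M: "\<And>m k. m \<ge> M \<Longrightarrow> k \<ge> M \<Longrightarrow> norm (X m - X k) < e"
      using CauchyD[OF C] by blast
    have "norm (seq (X m) n - seq (X k) n) < e" if "m \<ge> M" "k \<ge> M" for m k
      using coord[of "X m - X k" n] M[OF that] by (simp add: minus_ell1.rep_eq)
    then show "\<exists>M. \<forall>m\<ge>M. \<forall>k\<ge>M. norm (seq (X m) n - seq (X k) n) < e" by blast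
  qed
  then have "\<exists>l. (\<lambda>m. seq (X m) n) \<longlonglongrightarrow> l" for n
    using Cauchy_convergent convergent_def by blast
  then obtain l where l: "\<And>n. (\<lambda>m. seq (X m) n) \<longlonglongrightarrow> l n" by metis
  have bound: "\<exists>M. \<forall>m\<ge>M. \<forall>N. (\<Sum>n<N. norm (seq (X m) n - l n)) \<le> e" if e: "e > 0" for e
  proof -
    obtain M where M: "\<And>m k. m \<ge> M \<Longrightarrow> k \<ge> M \<Longrightarrow> norm (X m - X k) < e"
      using CauchyD[OF C e] by blast
    have "(\<Sum>n<N. norm (seq (X m) n - l n)) \<le> e" if m: "m \<ge> M" for m N
    proof (rule LIMSEQ_le_const2)
      show "(\<lambda>k. \<Sum>n<N. norm (seq (X m) n - seq (X k) n)) \<longlonglongrightarrow> (\<Sum>n<N. norm (seq (X m) n - l n))"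
        by (intro tendsto_intros l)
      have "(\<Sum>n<N. norm (seq (X m) n - seq (X k) n)) \<le> e" if "k \<ge> M" for k
        using le_norm[of "X m - X k" N] M[OF m that] by (simp add: minus_ell1.rep_eq)
      then show "\<exists>K. \<forall>k\<ge>K. (\<Sum>n<N. norm (seq (X m) n - seq (X k) n)) \<le> e" by blast
    qed
    then show ?thesis by blast
  qed
  have summ: "summable (\<lambda>n. norm (f n))"
    if "\<And>N. (\<Sum>n<N. norm (f n)) \<le> e" for f :: "nat \<Rightarrow> complex" and e
    using that by (intro bounded_imp_summable[of _ e]) (auto simp: lessThan_Suc_atMost[symmetric] simp del: sum.lessThan_Suc)
  obtain M where "\<forall>N. (\<Sum>n<N. norm (seq (X M) n - l n)) \<le> 1" using bound[of 1] by auto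
  then have "summable (\<lambda>n. norm (seq (X M) n - l n))" by (intro summ) auto
  then have "summable (\<lambda>n. norm (seq (X M) n) + norm (seq (X M) n - l n))"
    by (intro summable_add) auto
  then have "summable (\<lambda>n. norm (l n))"
  proof (rule summable_comparison_test')
    show "norm (norm (l n)) \<le> norm (seq (X M) n) + norm (seq (X M) n - l n)" for n
      using norm_triangle_ineq4[of "seq (X M) n" "seq (X M) n - l n"] by simp
  qed
  then have seqL: "seq (Abs_ell1 l) = l" by (simp add: Abs_ell1_inverse)
  have "X \<longlonglongrightarrow> Abs_ell1 l"
  proof (rule LIMSEQ_I)
    fix e :: real assume "e > 0"
    then obtain M where M: "\<And>m N. m \<ge> M \<Longrightarrow> (\<Sum>n<N. norm (seq (X m) n - l n)) \<le> e/2"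
      using bound[of "e/2"] by auto
    have "norm (X m - Abs_ell1 l) < e" if "m \<ge> M" for m
    proof -
      have "norm (X m - Abs_ell1 l) \<le> e/2"
        unfolding norm_ell1.rep_eq
        by (rule suminf_le_const) (use M[OF that] summ[OF M[OF that]] in \<open>auto simp: minus_ell1.rep_eq seqL\<close>)
      with \<open>e > 0\<close> show ?thesis by simp
    qed
    then show "\<exists>M. \<forall>m\<ge>M. norm (X m - Abs_ell1 l) < e" by blast
  qed
  then show "convergent X" by (auto simp: convergent_def)
qed

interpretation ell1: vector_space scaleC
  by standard (transfer; simp add: fun_eq_iff algebra_simps)+


section \<open>Weighted backward shifts\<close>

definition weight :: "(nat \<Rightarrow> complex) \<Rightarrow> bool" where
  "weight w \<longleftrightarrow> w 0 = 1 \<and> (\<forall>n. w n \<noteq> 0)"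

text \<open>
  Since \<open>seq (T x)\<close> is automatically absolutely summable, such a \<open>T\<close> exists iff \<open>B\<^sub>w\<close>
  maps \<open>\<ell>\<^sup>1\<close> into itself, and then \<open>T\<close> is \<open>B\<^sub>w\<close>.
\<close>

definition weighted_backward_shift :: "(nat \<Rightarrow> complex) \<Rightarrow> (ell1 \<Rightarrow> ell1) \<Rightarrow> bool" where
  "weighted_backward_shift w T \<longleftrightarrow>
     weight w \<and> (\<forall>x. seq (T x) = (\<lambda>n. w (Suc n) * seq x (Suc n)))"

lift_definition backward_shift :: "ell1 \<Rightarrow> ell1" is "\<lambda>x n. x (Suc n)"
  by (subst summable_Suc_iff)


section \<open>Linear dynamics\<close>

definition mixing :: "('a::topological_space \<Rightarrow> 'a) \<Rightarrow> bool" where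
  "mixing T \<longleftrightarrow>
     (\<forall>U V. open U \<longrightarrow> U \<noteq> {} \<longrightarrow> open V \<longrightarrow> V \<noteq> {} \<longrightarrow>
        finite (- {n. (T ^^ n) ` U \<inter> V \<noteq> {}}))"

definition HC :: "('a::topological_space \<Rightarrow> 'a) \<Rightarrow> 'a set" where
  "HC T = {x. closure (range (\<lambda>n. (T ^^ n) x)) = UNIV}"


section \<open>Algebrability\<close>

text \<open>Subalgebras are complex linear subspaces and need not contain the unit.\<close>

definition subalgebra :: "ell1 set \<Rightarrow> bool" where
  "subalgebra A \<longleftrightarrow> ell1.subspace A \<and> (\<forall>x\<in>A. \<forall>y\<in>A. x * y \<in> A)"

definition algebrable :: "ell1 set \<Rightarrow> bool" where
  "algebrable M \<longleftrightarrow>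
     (\<exists>A. subalgebra A \<and> A \<subseteq> M \<union> {0} \<and>
        (\<exists>S. infinite S \<and> A = subalgebra hull S) \<and>
        \<not> (\<exists>S. finite S \<and> A = subalgebra hull S))"

end

theory Submission
  imports Defs
begin

text \<open>
  A Baire category argument yields a pair \<open>(x, y)\<close> such that, for every monomial \<open>x ^ i * y ^ j\<close> with
  \<open>i \<ge> 1\<close> and every target \<open>t\<close>, some power of \<open>B\<^sub>w\<close> brings this monomial close to \<open>t\<close> and all
  lexicographically smaller ones of bounded degree close to 0. Looking at the leading monomial, every
  nonzero polynomial in \<open>x\<close> and \<open>y\<close> that is divisible by \<open>x\<close> is then hypercyclic. These polynomials
  form an algebra, which is infinitely but not finitely generated. Aiming with the highest
  monomial is what makes the argument work for arbitrary mixing weights: the lower ones are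
  annihilated by the shift, and there are no higher ones to control.
\<close>

section \<open>Finitely supported sequences\<close>

lemma seq_add [simp]: "seq (x + y) n = seq x n + seq y n"
  by (simp add: plus_ell1.rep_eq)

lemma seq_diff [simp]: "seq (x - y) n = seq x n - seq y n"
  by (simp add: minus_ell1.rep_eq)

lemma seq_zero [simp]: "seq 0 n = 0"
  by (simp add: zero_ell1.rep_eq)

lemma seq_one: "seq 1 n = (if n = 0 then 1 else 0)"
  by (simp add: one_ell1.rep_eq)

lemma seq_scaleC [simp]: "seq (c *\<^sub>C x) n = c * seq x n"
  by (simp add: scaleC.rep_eq)

lemma seq_scaleR [simp]: "seq (r *\<^sub>R x) n = r *\<^sub>R seq x n"
  by (simp add: scaleR_ell1.rep_eq)

lemma seq_mult: "seq (x * y) n = (\<Sum>k\<le>n. seq x k * seq y (n - k))"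
  by (simp add: times_ell1.rep_eq)

lemma scaleC_mult_left: "(c *\<^sub>C x) * y = c *\<^sub>C (x * y)"
  by (rule ell1_eqI) (simp add: seq_mult sum_distrib_left mult.assoc)

lemma scaleC_mult_right: "x * (c *\<^sub>C y) = c *\<^sub>C (x * y)"
  by (metis mult.commute scaleC_mult_left)

lemma norm_scaleC: "norm (c *\<^sub>C x) = norm c * norm x"
  by (simp add: norm_ell1.rep_eq norm_mult suminf_mult)

lemma norm_seq_le: "norm (seq x n) \<le> norm x"
  using sum_le_suminf[OF summable_norm_seq[of x], of "{n}"] by (simp add: norm_ell1.rep_eq)

lemma norm_ell1_le:
  assumes "\<And>n. norm (seq x n) \<le> C * norm (seq y n)"
  shows "norm x \<le> C * norm y"
  unfolding norm_ell1.rep_eq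
  by (subst suminf_mult[symmetric]) (auto intro!: suminf_le summable_mult assms)

lift_definition finseq :: "nat \<Rightarrow> (nat \<Rightarrow> complex) \<Rightarrow> ell1"
  is "\<lambda>N f n. if n < N then f n else 0"
  by (rule summable_finite[of "{..<_}"]) auto

lemma seq_finseq: "seq (finseq N f) n = (if n < N then f n else 0)"
  by (simp add: finseq.rep_eq)

lemma norm_finseq: "norm (finseq N f) = (\<Sum>n<N. norm (f n))"
  unfolding norm_ell1.rep_eq
  by (subst suminf_finite[of "{..<N}"]) (auto simp: seq_finseq)

lemma finseq_truncation_tendsto: "(\<lambda>N. finseq N (seq x)) \<longlonglongrightarrow> x"
proof (rule LIMSEQ_I)
  fix e :: real assume "e > 0"
  then obtain N0 where N0: "\<And>N. N \<ge> N0 \<Longrightarrow> norm (\<Sum>n. norm (seq x (n + N))) < e"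
    using suminf_exist_split[of e "\<lambda>n. norm (seq x n)"] by auto
  have "norm (finseq N (seq x) - x) < e" if "N \<ge> N0" for N
  proof -
    have "norm (finseq N (seq x) - x)
        = (\<Sum>n. norm (seq (finseq N (seq x) - x) (n + N)))"
      unfolding norm_ell1.rep_eq
      by (subst suminf_split_initial_segment[where k = N])
        (simp_all only: summable_norm_seq, simp add: seq_finseq)
    also have "\<dots> = (\<Sum>n. norm (seq x (n + N)))"
      by (simp add: seq_finseq)
    finally show ?thesis using N0[OF that] by simp
  qed
  then show "\<exists>N0. \<forall>N\<ge>N0. norm (finseq N (seq x) - x) < e" by blast
qed

text \<open>Read as power series, the degree is at most \<open>L\<close>. Only an upper bound is
  recorded, so zero is covered by every \<open>L\<close> and products need no case
  distinction.\<close>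

definition supp_le :: "nat \<Rightarrow> ell1 \<Rightarrow> bool" where
  "supp_le L x \<longleftrightarrow> (\<forall>n>L. seq x n = 0)"

lemma supp_le_mono: "supp_le L x \<Longrightarrow> L \<le> L' \<Longrightarrow> supp_le L' x"
  by (simp add: supp_le_def)

lemma supp_le_add: "supp_le L x \<Longrightarrow> supp_le L y \<Longrightarrow> supp_le L (x + y)"
  by (simp add: supp_le_def)

lemma supp_le_mult:
  assumes "supp_le L x" "supp_le M y"
  shows "supp_le (L + M) (x * y)"
  unfolding supp_le_def seq_mult
proof (intro allI impI sum.neutral ballI)
  fix n k assume "L + M < n" "k \<in> {..n}"
  then have "k > L \<or> n - k > M" by auto
  then show "seq x k * seq y (n - k) = 0" using assms by (auto simp: supp_le_def)
qed

lemma supp_le_power: "supp_le L x \<Longrightarrow> supp_le (k * L) (x ^ k)"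
  by (induction k) (auto simp: supp_le_def seq_one supp_le_mult[unfolded supp_le_def])

lemma supp_le_of_real: "supp_le L (of_real a)"
  by (simp add: supp_le_def of_real_def seq_one)

lemma supp_le_finseq: "N \<le> Suc L \<Longrightarrow> supp_le L (finseq N f)"
  by (simp add: supp_le_def seq_finseq)

text \<open>The basis vector with index 1: multiplication by it is the forward shift, and
  \<open>shift_unit ^ k\<close> is the basis vector with index \<open>k\<close>.\<close>

lift_definition shift_unit :: ell1 is "\<lambda>n. if n = 1 then 1 else 0"
  by (rule summable_finite[of "{1}"]) auto

lemma norm_shift_unit: "norm shift_unit = 1"
  by transfer (subst suminf_finite[of "{1}"], auto)

lemma seq_shift_unit_mult: "seq (shift_unit * x) n = (if n = 0 then 0 else seq x (n - 1))"
proof -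
  have "seq (shift_unit * x) n = (\<Sum>k\<le>n. if k = 1 then seq x (n - 1) else 0)"
    unfolding seq_mult by (intro sum.cong) (auto simp: shift_unit.rep_eq)
  then show ?thesis by (simp add: sum.delta')
qed

lemma seq_shift_power_mult:
  "seq (shift_unit ^ k * x) n = (if n < k then 0 else seq x (n - k))"
  by (induction k arbitrary: n) (auto simp: seq_shift_unit_mult mult.assoc)

lemma norm_shift_power_le: "norm (shift_unit ^ k) \<le> 1"
  using norm_power_ineq[of shift_unit k] by (simp add: norm_shift_unit)

lemma norm_shift_power_mult_le: "norm (shift_unit ^ k * x) \<le> norm x"
  by (metis mult.left_neutral mult_right_mono norm_ge_zero norm_mult_ineq norm_shift_power_le order_trans)

lemma supp_le_shift_power: "supp_le k (shift_unit ^ k)"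
  using seq_shift_power_mult[of k 1] by (simp add: supp_le_def seq_one)

text \<open>Supplies countably many finitely supported targets for the category argument: truncate,
  then round the coordinates to a countable dense set of complex numbers.\<close>

lemma countable_dense_finseq:
  obtains Q where "countable Q" "\<And>t e. e > 0 \<Longrightarrow> \<exists>q\<in>Q. norm (q - t) < e"
    "\<And>q. q \<in> Q \<Longrightarrow> \<exists>N f. q = finseq N f"
proof -
  obtain C :: "complex set" where C: "countable C"
    "\<And>X. open X \<Longrightarrow> X \<noteq> {} \<Longrightarrow> \<exists>d\<in>C. d \<in> X"
    using countable_dense_exists by metis
  define Q where "Q = (\<lambda>l. finseq (length l) (nth l)) ` lists C"
  show ?thesis
  proof (rule that)
    show "countable Q" unfolding Q_def using C(1) by auto
    show "\<exists>N f. q = finseq N f" if "q \<in> Q" for q using that unfolding Q_def by auto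
    fix t and e :: real assume e: "e > 0"
    have "\<forall>\<^sub>F N in sequentially. dist (finseq N (seq t)) t < e / 2"
      using finseq_truncation_tendsto e half_gt_zero tendstoD by blast
    then obtain N where N: "norm (finseq N (seq t) - t) < e / 2"
      by (auto simp: eventually_sequentially dist_norm)
    have "\<exists>c\<in>C. norm (c - seq t n) < e / (2 * Suc N)" for n
    proof -
      have "e / (2 * Suc N) > 0" using e by simp
      then obtain d where "d \<in> C" "d \<in> ball (seq t n) (e / (2 * Suc N))"
        using C(2)[of "ball (seq t n) (e / (2 * Suc N))"] by (metis centre_in_ball empty_iff open_ball)
      then show ?thesis by (auto simp: dist_norm norm_minus_commute)
    qed
    then obtain c where c: "\<And>n. c n \<in> C" "\<And>n. norm (c n - seq t n) < e / (2 * Suc N)"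
      by metis
    define q where "q = finseq N c"
    have "q = finseq (length (map c [0..<N])) (nth (map c [0..<N]))"
      unfolding q_def by (rule ell1_eqI) (simp add: seq_finseq)
    then have "q \<in> Q" unfolding Q_def using c(1)
      by (intro image_eqI[where x = "map c [0..<N]"]) auto
    have "q - finseq N (seq t) = finseq N (\<lambda>n. c n - seq t n)"
      unfolding q_def by (rule ell1_eqI) (simp add: seq_finseq)
    then have "norm (q - finseq N (seq t)) = (\<Sum>n<N. norm (c n - seq t n))"
      by (simp add: norm_finseq)
    also have "\<dots> \<le> (\<Sum>n<N. e / (2 * Suc N))" by (intro sum_mono less_imp_le c(2))
    also have "\<dots> \<le> e / 2" using e by (simp add: field_simps)
    finally have "norm (q - t) < e"
      using N norm_triangle_ineq[of "q - finseq N (seq t)" "finseq N (seq t) - t"] by simp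
    with \<open>q \<in> Q\<close> show "\<exists>q\<in>Q. norm (q - t) < e" by blast
  qed
qed

section \<open>Weighted backward shifts\<close>

lemma bounded_linear_seq: "bounded_linear (\<lambda>x. seq x n)"
  by (rule bounded_linear_intro[where K = 1]) (auto simp: norm_seq_le)

lemma seq_backward_shift [simp]: "seq (backward_shift x) n = seq x (Suc n)"
  by (simp add: backward_shift.rep_eq)

lemma norm_backward_shift_le: "norm (backward_shift x) \<le> norm x"
  using suminf_split_head[OF summable_norm_seq[of x]]
  by (simp add: norm_ell1.rep_eq)

locale weighted_shift =
  fixes w :: "nat \<Rightarrow> complex" and T :: "ell1 \<Rightarrow> ell1"
  assumes shift: "weighted_backward_shift w T"
begin

definition v :: "nat \<Rightarrow> complex" where "v n = (\<Prod>k\<in>{1..n}. w k)"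

lemma w_nz: "w n \<noteq> 0" and w_0: "w 0 = 1"
  using shift by (auto simp: weighted_backward_shift_def weight_def)

lemma seq_T: "seq (T x) n = w (Suc n) * seq x (Suc n)"
  using shift by (simp add: weighted_backward_shift_def)

lemma v_0 [simp]: "v 0 = 1"
  by (simp add: v_def)

lemma v_Suc: "v (Suc n) = v n * w (Suc n)"
  by (simp add: v_def)

lemma v_nz [simp]: "v n \<noteq> 0"
  by (simp add: v_def w_nz)

text \<open>Multiplying coordinate \<open>n\<close> by \<open>v n\<close> conjugates
  \<open>T\<close> to the unweighted shift, whence the quotient.\<close>

lemma seq_funpow: "seq ((T ^^ n) x) q = v (q + n) / v q * seq x (q + n)"
proof (induction n arbitrary: q)
  case (Suc n)
  then show ?case by (simp add: seq_T v_Suc w_nz)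
qed simp

lemma funpow_add: "(T ^^ n) (x + y) = (T ^^ n) x + (T ^^ n) y"
  by (rule ell1_eqI) (simp add: seq_funpow algebra_simps)

lemma funpow_zero [simp]: "(T ^^ n) 0 = 0"
  by (rule ell1_eqI) (simp add: seq_funpow)

lemma funpow_scaleC: "(T ^^ n) (c *\<^sub>C x) = c *\<^sub>C (T ^^ n) x"
  by (rule ell1_eqI) (simp add: seq_funpow)

lemma funpow_sum: "(T ^^ n) (sum f A) = (\<Sum>a\<in>A. (T ^^ n) (f a))"
  by (induction A rule: infinite_finite_induct) (auto simp: funpow_add)

lemma funpow_eq_0: "supp_le L x \<Longrightarrow> L < n \<Longrightarrow> (T ^^ n) x = 0"
  by (rule ell1_eqI) (simp add: seq_funpow supp_le_def)

text \<open>
  If the weights were unbounded, say \<open>norm (w (m k)) > 4 ^ k\<close>, then the vector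
  \<open>\<Sum>k. 2 ^ (-k) e\<^bsub>m k\<^esub>\<close> would be mapped to an unbounded sequence.
\<close>

lemma bounded_weights: "\<exists>W\<ge>1. \<forall>n. norm (w n) \<le> W"
proof (rule ccontr)
  assume "\<not> ?thesis"
  then have "\<exists>n. norm (w n) > W" if "W \<ge> 1" for W using that by (metis linorder_not_le)
  from this[of "4 ^ _"] have "\<exists>n. norm (w n) > 4 ^ k" for k by simp
  then obtain m where m: "\<And>k. norm (w (m k)) > 4 ^ k" by metis
  \<comment> \<open>Coordinate \<open>m k\<close> of a vector must have a predecessor
    \<open>m k - 1\<close> to which \<open>T\<close> moves it.\<close>
  have mnz: "m k \<noteq> 0" for k
    using m[of k] w_0 one_le_power[of "4::real" k] by (metis linorder_not_le norm_one numeral_le_iff one_le_numeral)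
  define f where "f k = (1/2::real) ^ k *\<^sub>R shift_unit ^ m k" for k
  have seqf: "seq (f k) n = (if n = m k then (1/2) ^ k else 0)" for k n
    using seq_shift_power_mult[of "m k" 1 n]
    by (auto simp: f_def seq_one scaleR_conv_of_real[where 'a = complex])
  have "summable f"
  proof (rule summable_comparison_test')
    show "summable (\<lambda>k. (1/2::real) ^ k)" by (simp add: summable_geometric)
    show "norm (f k) \<le> (1/2) ^ k" if "k \<ge> 0" for k
      using norm_shift_power_le[of "m k"] by (simp add: f_def power_one_over divide_right_mono)
  qed
  define x where "x = suminf f"
  have "f sums x" unfolding x_def using \<open>summable f\<close> by (simp add: summable_sums)
  then have sums: "(\<lambda>k. Re (seq (f k) n)) sums Re (seq x n)" for n
    by (intro sums_Re bounded_linear.sums[OF bounded_linear_seq])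
  \<comment> \<open>Only a lower bound holds: \<open>m\<close> need not be injective, so several
    terms may meet in one coordinate, but all of them are nonnegative reals.\<close>
  have x: "(1/2) ^ k \<le> norm (seq x (m k))" for k
  proof -
    have "(\<Sum>j\<in>{k}. Re (seq (f j) (m k))) \<le> (\<Sum>j. Re (seq (f j) (m k)))"
      using sums[of "m k"] by (intro sum_le_suminf) (auto simp: sums_iff seqf)
    also have "\<dots> = Re (seq x (m k))" using sums[of "m k"] by (simp add: sums_iff)
    also have "\<dots> \<le> norm (seq x (m k))" by (rule complex_Re_le_cmod)
    finally show ?thesis by (simp add: seqf)
  qed
  have "2 ^ k \<le> norm (T x)" for k
  proof -
    have "(2::real) ^ k = 4 ^ k * (1/2) ^ k" by (simp flip: power_mult_distrib)
    also have "\<dots> \<le> norm (w (m k)) * norm (seq x (m k))"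
      using m[of k] x[of k] by (intro mult_mono) auto
    also have "\<dots> = norm (seq (T x) (m k - 1))"
      using mnz[of k] by (simp add: seq_T norm_mult)
    also have "\<dots> \<le> norm (T x)" by (rule norm_seq_le)
    finally show ?thesis .
  qed
  then show False
    using real_arch_pow[of 2 "norm (T x)"] by (auto simp: linorder_not_le[symmetric])
qed

lemma continuous_funpow: "continuous_on UNIV (T ^^ n)"
proof -
  obtain W where W: "W \<ge> 1" "\<And>n. norm (w n) \<le> W" using bounded_weights by blast
  have "norm (T x) \<le> norm x * W" for x
  proof -
    have "norm (T x) \<le> W * norm (backward_shift x)"
      using W by (intro norm_ell1_le) (auto simp: seq_T norm_mult mult_right_mono)
    also have "\<dots> \<le> W * norm x"
      using norm_backward_shift_le[of x] W(1) by (intro mult_left_mono) auto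
    finally show ?thesis by (simp add: mult.commute)
  qed
  moreover have "T (x + y) = T x + T y" "T (r *\<^sub>R x) = r *\<^sub>R T x" for x y r
    by (rule ell1_eqI; simp add: seq_T algebra_simps)+
  ultimately have "bounded_linear T"
    by (intro bounded_linear_intro[where K = W]) auto
  then have T: "continuous_on S T" for S by (rule linear_continuous_on)
  show ?thesis
  proof (induction n)
    case (Suc n)
    show ?case
      using continuous_on_compose[OF Suc T] by simp
  qed (simp add: id_def)
qed

text \<open>Mixing brings, for almost all \<open>n\<close>, a vector of norm below \<open>d\<close>
  close to the unit. Coordinate 0 then gives \<open>1/2 \<le> norm (v n) * d\<close>, and
  \<open>d\<close> is arbitrarily small.\<close>

lemma v_at_top:
  assumes "mixing T"
  shows "filterlim (\<lambda>n. norm (v n)) at_top sequentially"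
  unfolding filterlim_at_top
proof
  fix Z :: real
  define d where "d = 1 / (2 * (\<bar>Z\<bar> + 1))"
  have d: "d > 0" by (simp add: d_def)
  define U V :: "ell1 set" where "U = ball 0 d" and "V = ball 1 (1/2)"
  have "open U" "open V" "U \<noteq> {}" "V \<noteq> {}" using d by (auto simp: U_def V_def)
  with assms have "finite (- {n. (T ^^ n) ` U \<inter> V \<noteq> {}})"
    unfolding mixing_def by blast
  then have "\<forall>\<^sub>F n in sequentially. (T ^^ n) ` U \<inter> V \<noteq> {}"
    by (simp add: cofinite_eq_sequentially[symmetric] eventually_cofinite Compl_eq)
  then show "\<forall>\<^sub>F n in sequentially. Z \<le> norm (v n)"
  proof eventually_elim
    case (elim n)
    then obtain x where x: "norm x < d" "norm (1 - (T ^^ n) x) < 1/2"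
      by (auto simp: U_def V_def dist_norm)
    have "norm (1 - v n * seq x n) < 1/2"
      using norm_seq_le[of "1 - (T ^^ n) x" 0] x(2) by (simp add: seq_one seq_funpow)
    then have "1/2 \<le> norm (v n * seq x n)"
      using norm_triangle_ineq2[of 1 "v n * seq x n"] by simp
    also have "\<dots> \<le> norm (v n) * d"
      using norm_seq_le[of x n] x(1) by (auto simp: norm_mult intro!: mult_left_mono)
    finally have "norm (v n) \<ge> \<bar>Z\<bar> + 1" by (simp add: d_def field_simps)
    then show ?case by simp
  qed
qed

end

section \<open>Rolewicz operators\<close>

lemma weighted_backward_shift_Rolewicz:
  assumes "c \<noteq> 0"
  shows "weighted_backward_shift (\<lambda>n. if n = 0 then 1 else c) (\<lambda>x. c *\<^sub>C backward_shift x)"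
  using assms by (auto simp: weighted_backward_shift_def weight_def)

text \<open>A truncated point \<open>x0\<close> of \<open>U\<close> is killed by high powers, while
  \<open>z n\<close> is a preimage of \<open>y\<close> under \<open>T ^^ n\<close> that tends to 0.
  So \<open>x0 + z n\<close> lies in \<open>U\<close> eventually and is sent exactly to
  \<open>y\<close>.\<close>

lemma mixing_Rolewicz:
  assumes "norm c > 1"
  shows "mixing (\<lambda>x. c *\<^sub>C backward_shift x)"
  unfolding mixing_def
proof (intro allI impI)
  define T where "T = (\<lambda>x. c *\<^sub>C backward_shift x)"
  have c: "c \<noteq> 0" using assms by auto
  fix U V :: "ell1 set"
  assume U: "open U" "U \<noteq> {}" and V: "open V" "V \<noteq> {}"
  obtain x y where x: "x \<in> U" and y: "y \<in> V" using U V by auto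
  have "\<forall>\<^sub>F N in sequentially. finseq N (seq x) \<in> U"
    using finseq_truncation_tendsto U(1) x by (rule topological_tendstoD)
  then obtain N where N: "finseq N (seq x) \<in> U" by (auto simp: eventually_sequentially)
  define x0 where "x0 = finseq N (seq x)"
  define z where "z n = inverse c ^ n *\<^sub>C (shift_unit ^ n * y)" for n
  have seqT: "seq ((T ^^ n) u) q = c ^ n * seq u (q + n)" for n u q
    by (induction n arbitrary: q) (simp_all add: T_def)
  have "z \<longlonglongrightarrow> 0"
  proof (rule Lim_null_comparison)
    show "\<forall>\<^sub>F n in sequentially. norm (z n) \<le> inverse (norm c) ^ n * norm y"
      by (intro always_eventually allI)
        (simp add: z_def norm_scaleC norm_power norm_inverse mult_left_mono norm_shift_power_mult_le)
    show "(\<lambda>n. inverse (norm c) ^ n * norm y) \<longlonglongrightarrow> 0"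
      using assms by (intro tendsto_mult_left_zero LIMSEQ_power_zero) (simp add: inverse_less_1_iff)
  qed
  then have "(\<lambda>n. x0 + z n) \<longlonglongrightarrow> x0" using tendsto_add[OF tendsto_const, of z 0 _ x0] by simp
  then have "\<forall>\<^sub>F n in sequentially. x0 + z n \<in> U"
    using U(1) N unfolding x0_def by (rule topological_tendstoD)
  moreover have "\<forall>\<^sub>F n in sequentially. n \<ge> N" by (rule eventually_ge_at_top)
  ultimately have "\<forall>\<^sub>F n in sequentially. (T ^^ n) ` U \<inter> V \<noteq> {}"
  proof eventually_elim
    case (elim n)
    have "(T ^^ n) (x0 + z n) = y"
      using elim(2) c by (intro ell1_eqI)
        (simp add: seqT x0_def z_def seq_finseq seq_shift_power_mult power_mult_distrib[symmetric])
    with elim(1) y show ?case by auto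
  qed
  then show "finite (- {n. ((\<lambda>x. c *\<^sub>C backward_shift x) ^^ n) ` U \<inter> V \<noteq> {}})"
    by (simp add: cofinite_eq_sequentially[symmetric] eventually_cofinite Compl_eq T_def)
qed

section \<open>Hitting a target with a leading monomial\<close>

text \<open>Each term in the expansion of the difference contains a factor \<open>x\<close>, whose
  degree bound is lower than that of \<open>F\<close> by \<open>K\<close>.\<close>

lemma supp_le_power_add_diff:
  assumes "supp_le M x" "supp_le (M + K) F"
  shows "supp_le (i * (M + K) - K) ((F + x) ^ i - F ^ i)"
proof (induction i)
  case 0
  show ?case by (simp add: supp_le_def)
next
  case (Suc i)
  have Fx: "supp_le (M + K) (F + x)"
    by (intro supp_le_add supp_le_mono[OF assms(1)] assms(2)) simp
  have 1: "supp_le (Suc i * (M + K) - K) (((F + x) ^ i - F ^ i) * (F + x))"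
  \<comment> \<open>For \<open>i = 0\<close> the truncated subtraction would spoil the count, but
    the difference of powers is zero.\<close>
  proof (cases i)
    case 0
    then show ?thesis by (simp add: supp_le_def)
  next
    case (Suc j)
    then show ?thesis
      using supp_le_mult[OF Suc.IH Fx] by (simp add: algebra_simps)
  qed
  have 2: "supp_le (Suc i * (M + K) - K) (F ^ i * x)"
    using supp_le_mult[OF supp_le_power[OF assms(2), of i] assms(1)] by (simp add: algebra_simps)
  have "(F + x) ^ Suc i - F ^ Suc i = ((F + x) ^ i - F ^ i) * (F + x) + F ^ i * x"
    by (simp add: algebra_simps)
  with supp_le_add[OF 1 2] show ?case by simp
qed

text \<open>Second-order binomial expansion, by induction: multiplication by \<open>a + z\<close>
  turns the remainder \<open>R\<close> into \<open>(a + z) * R + i * a ^ (i - 1)\<close>, of norm at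
  most \<open>2 * 3 ^ i + 3 ^ i\<close>. The bound on \<open>R\<close> is uniform in
  \<open>a\<close> and \<open>z\<close>.\<close>

lemma power_add_quadratic_remainder:
  fixes z :: ell1
  assumes "0 \<le> a" "a \<le> 1" "norm z \<le> 1" "supp_le L z"
  shows "\<exists>R. (of_real a + z) ^ i = of_real (a ^ i) + of_real (real i * a ^ (i - 1)) * z + z ^ 2 * R
    \<and> norm R \<le> 3 ^ i \<and> supp_le (i * L) R"
proof (induction i)
  case 0
  show ?case by (intro exI[of _ 0]) (simp add: supp_le_def)
next
  case (Suc i)
  then obtain R where R: "(of_real a + z) ^ i
      = of_real (a ^ i) + of_real (real i * a ^ (i - 1)) * z + z ^ 2 * R"
    and nR: "norm R \<le> 3 ^ i" and sR: "supp_le (i * L) R" by blast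
  define b where "b = real i * a ^ (i - 1)"
  have ab: "a * b = real i * a ^ i"
    unfolding b_def by (cases i) auto
  have b: "0 \<le> b" "b \<le> real i"
    using assms(1,2) by (auto simp: b_def intro!: mult_left_le power_le_one)
  have i3: "real i \<le> 3 ^ i"
  proof (induction i)
    case (Suc i)
    with one_le_power[of "3::real" i] show ?case unfolding of_nat_Suc power_Suc by linarith
  qed simp
  define R' where "R' = (of_real a + z) * R + of_real b"
  have "(of_real a + z) ^ Suc i = (of_real a + z) * (of_real (a ^ i) + of_real b * z + z ^ 2 * R)"
    by (simp add: R b_def)
  also have "\<dots> = of_real (a * a ^ i) + (of_real (a * b) + of_real (a ^ i)) * z + z ^ 2 * R'"
    by (simp add: R'_def algebra_simps power2_eq_square)
  also have "of_real (a * b) + of_real (a ^ i) = (of_real (real (Suc i) * a ^ (Suc i - 1)) :: ell1)"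
    unfolding ab by (simp add: algebra_simps)
  finally have eq: "(of_real a + z) ^ Suc i
      = of_real (a ^ Suc i) + of_real (real (Suc i) * a ^ (Suc i - 1)) * z + z ^ 2 * R'"
    by simp
  have "norm (of_real a + z) \<le> 2"
    using norm_triangle_ineq[of "of_real a" z] assms by simp
  then have "norm ((of_real a + z) * R) \<le> 2 * 3 ^ i"
    using nR by (intro order_trans[OF norm_mult_ineq] mult_mono) auto
  then have n: "norm R' \<le> 3 ^ Suc i"
    unfolding R'_def
    using norm_triangle_ineq[of "(of_real a + z) * R" "of_real b"] b i3
    unfolding power_Suc norm_of_real by linarith
  have "supp_le (L + i * L) R'"
    unfolding R'_def
    by (intro supp_le_add supp_le_mult supp_le_of_real assms(4) sR)
  with eq n show ?case by auto
qed

section \<open>Iterates of the shift on right-shifted sequences\<close>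

context weighted_shift
begin

lemma seq_funpow_shift_mult: "seq ((T ^^ n) (shift_unit ^ n * x)) q = v (q + n) / v q * seq x q"
  by (simp add: seq_funpow seq_shift_power_mult)

lemma norm_v_add_le:
  assumes "\<And>n. norm (w n) \<le> W"
  shows "norm (v (m + q)) \<le> W ^ q * norm (v m)"
proof (induction q)
  case (Suc q)
  have "norm (v (m + Suc q)) = norm (w (Suc (m + q))) * norm (v (m + q))"
    by (simp add: v_Suc norm_mult)
  also have "\<dots> \<le> W * (W ^ q * norm (v m))"
    using Suc assms[of "Suc (m + q)"] by (intro mult_mono) (auto intro: order_trans[OF norm_ge_zero])
  finally show ?case by (simp add: mult.assoc)
qed simp

text \<open>The operator is diagonal with entries \<open>v (q + n) / v q\<close>. The factor
  \<open>b\<close> is carried along because in the application \<open>norm (v (q + n))\<close> is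
  bounded only after multiplication by a small \<open>b\<close>.\<close>

lemma norm_funpow_shift_mult_le:
  assumes supp: "supp_le Q x"
    and V: "\<And>q. q \<le> Q \<Longrightarrow> 1 \<le> V * norm (v q)"
    and C: "\<And>q. q \<le> Q \<Longrightarrow> seq x q \<noteq> 0 \<Longrightarrow> b * norm (v (q + n)) \<le> C"
    and pos: "0 \<le> b" "0 \<le> C" "0 \<le> V"
  shows "b * norm ((T ^^ n) (shift_unit ^ n * x)) \<le> C * V * norm x"
proof -
  have "norm (b *\<^sub>R (T ^^ n) (shift_unit ^ n * x)) \<le> C * V * norm x"
  proof (rule norm_ell1_le)
    fix q
    show "norm (seq (b *\<^sub>R (T ^^ n) (shift_unit ^ n * x)) q) \<le> C * V * norm (seq x q)"
    proof (cases "seq x q = 0")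
      case True
      then show ?thesis by (simp add: seq_funpow_shift_mult)
    next
      case False
      then have q: "q \<le> Q" using supp by (meson supp_le_def linorder_not_le)
      have "1 / norm (v q) \<le> V" using V[OF q] by (simp add: divide_le_eq)
      then have "(b * norm (v (q + n))) * (1 / norm (v q)) * norm (seq x q) \<le> C * V * norm (seq x q)"
        using C[OF q False] pos by (intro mult_right_mono mult_mono) auto
      then show ?thesis
        using pos by (simp add: seq_funpow_shift_mult norm_mult norm_divide)
    qed
  qed
  then show ?thesis using pos by simp
qed

text \<open>
  Perturb \<open>x0\<close>, \<open>y0\<close> by \<open>F = e\<^bsub>(D+1)N\<^esub> (a + e\<^sub>d \<beta>)\<close> and \<open>E = a e\<^sub>N\<close>. Since \<open>D + 1\<close> is a radix for the
  exponents, distinct monomials have degrees that are at least about \<open>N\<close> apart, so that \<open>T ^^ n\<close> kills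
  everything below \<open>x ^ i * y ^ j\<close> if \<open>n\<close> is \<open>d\<close> more than the degree of \<open>e\<^bsub>(D+1)N\<^esub> ^ i * e\<^sub>N ^ j\<close>.
  What survives of \<open>x ^ i * y ^ j\<close> is linear in \<open>\<beta>\<close>, and is \<open>t\<close> by the choice of \<open>\<beta>\<close>,
  up to a part quadratic in \<open>\<beta>\<close>, which is negligible as \<open>\<beta>\<close> tends to 0 while \<open>a\<close> stays fixed.
\<close>

lemma perturbation_hits_target:
  assumes v_lim: "filterlim (\<lambda>n. norm (v n)) at_top sequentially"
    and i: "1 \<le> i" "i \<le> D" and e: "e > 0"
    and x0: "supp_le M x0" and y0: "supp_le M y0" and t: "t = finseq p h"
  shows "\<exists>x y n. norm (x - x0) < e \<and> norm (y - y0) < e \<and> norm ((T ^^ n) (x ^ i * y ^ j) - t) < e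
    \<and> (\<forall>i'\<le>D. \<forall>j'. i' * (D + 1) + j' < i * (D + 1) + j \<longrightarrow> (T ^^ n) (x ^ i' * y ^ j') = 0)"
proof -

  \<comment> \<open>Constants and decay of the perturbation\<close>
  obtain W where W: "W \<ge> 1" "\<And>n. norm (w n) \<le> W" using bounded_weights by blast
  define a where "a = min 1 (e / 2)"
  have a: "0 < a" "a \<le> 1" "a \<le> e / 2" using e by (auto simp: a_def)
  \<comment> \<open>The coefficient of the term linear in \<open>z\<close> in
    \<open>(a + z) ^ i * a ^ j\<close>.\<close>
  define \<kappa> where "\<kappa> = real i * a ^ (i - 1) * a ^ j"
  have \<kappa>: "\<kappa> > 0" using a i by (simp add: \<kappa>_def)
  \<comment> \<open>\<open>L\<close> bounds the degree of the perturbation \<open>z\<close>, and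
    \<open>Q\<close> that of the quadratic part \<open>r\<close>. The choice of \<open>d\<close>
    makes it positive, so that the constant term dies, and at least \<open>p\<close>, so that
    \<open>r\<close> begins at or beyond the support of the target.\<close>
  define d L Q key where "d = Suc p" and "L = d + p" and "Q = d + (2 * p + i * L)"
    and "key = i * (D + 1) + j"
  have key: "key \<ge> 1" using i by (simp add: key_def)
  define n where "n N = key * N + d" for N
  \<comment> \<open>Solves \<open>v (l + n N) / v l * \<kappa> * seq (\<beta> N) l = h l\<close> for
    each \<open>l < p\<close>; the growth of \<open>v\<close> makes it tend to 0.\<close>
  define \<beta> where "\<beta> N = finseq p (\<lambda>l. h l * v l / (v (n N + l) * \<kappa>))" for N
  define C where "C = W ^ Q * (\<Sum>l<p. norm (h l * v l) / \<kappa>)"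
  define V where "V = (\<Sum>q\<le>Q. 1 / norm (v q))"
  have C: "C \<ge> 0" and V: "V \<ge> 0"
    unfolding C_def V_def using W \<kappa> by (auto intro!: mult_nonneg_nonneg sum_nonneg)
  have V1: "1 \<le> V * norm (v q)" if "q \<le> Q" for q
  proof -
    have "1 / norm (v q) \<le> V"
      unfolding V_def using that by (intro member_le_sum) auto
    then show ?thesis by (simp add: divide_le_eq)
  qed
  \<comment> \<open>The growth of \<open>v\<close> cancels the decay of \<open>\<beta>\<close>,
    uniformly in \<open>N\<close>. Upper bounds on the weights compare \<open>v (q + n N)\<close>
    with \<open>v (n N + l)\<close> only for \<open>q \<ge> l\<close>, hence
    \<open>p \<le> q\<close>.\<close>
  have \<beta>v: "norm (\<beta> N) * norm (v (q + n N)) \<le> C" if "p \<le> q" "q \<le> Q" for N q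
  proof -
    have "norm (h l * v l / (v (n N + l) * \<kappa>)) * norm (v (q + n N)) \<le> W ^ Q * (norm (h l * v l) / \<kappa>)"
      if "l < p" for l
    proof -
      have "norm (v (q + n N)) \<le> W ^ (q - l) * norm (v (n N + l))"
        using norm_v_add_le[OF W(2), of "n N + l" "q - l"] \<open>p \<le> q\<close> that by (simp add: add.commute)
      also have "\<dots> \<le> W ^ Q * norm (v (n N + l))"
        using W(1) \<open>q \<le> Q\<close> by (intro mult_right_mono power_increasing) auto
      finally have "norm (v (q + n N)) \<le> W ^ Q * norm (v (n N + l))" .
      then have "norm (h l * v l / (v (n N + l) * \<kappa>)) * norm (v (q + n N))
          \<le> norm (h l * v l / (v (n N + l) * \<kappa>)) * (W ^ Q * norm (v (n N + l)))"
        by (intro mult_left_mono) auto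
      also have "\<dots> = W ^ Q * (norm (h l * v l) / \<kappa>)"
        using \<kappa> by (simp add: norm_mult norm_divide)
      finally show ?thesis .
    qed
    then show ?thesis
      unfolding \<beta>_def norm_finseq C_def sum_distrib_left sum_distrib_right
      by (intro sum_mono) auto
  qed
  have \<beta>_lim: "(\<lambda>N. norm (\<beta> N)) \<longlonglongrightarrow> 0"
    unfolding \<beta>_def norm_finseq
  proof (rule tendsto_null_sum)
    fix l
    have "filterlim (\<lambda>N. n N + l) at_top sequentially"
    proof (rule filterlim_at_top_mono[OF filterlim_ident])
      show "\<forall>\<^sub>F N in sequentially. N \<le> n N + l"
        using key by (intro always_eventually allI) (simp add: n_def trans_le_add1)
    qed
    then have "filterlim (\<lambda>N. norm (v (n N + l))) at_top sequentially"
      by (rule filterlim_compose[OF v_lim])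
    then have "((\<lambda>N. norm (h l * v l) / \<kappa> / norm (v (n N + l))) \<longlongrightarrow> 0) sequentially"
      by (intro tendsto_divide_0[OF tendsto_const] filterlim_at_top_imp_at_infinity)
    then show "(\<lambda>N. norm (h l * v l / (v (n N + l) * \<kappa>))) \<longlonglongrightarrow> 0"
      using \<kappa> by (simp add: norm_mult norm_divide mult.commute)
  qed
  \<comment> \<open>In turn: for the quadratic expansion, for staying near \<open>x0\<close>, and
    for the final error; adding 1 keeps the denominator positive.\<close>
  define \<delta> where "\<delta> = min (min 1 (e / 2)) (e / (C * V * 3 ^ i + 1))"
  have "\<delta> > 0" using e C V by (auto simp: \<delta>_def intro!: divide_pos_pos add_nonneg_pos)
  with \<beta>_lim have "\<forall>\<^sub>F N in sequentially. norm (\<beta> N) < \<delta>"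
    by (rule order_tendstoD)
  moreover have "\<forall>\<^sub>F N in sequentially. N > M + (D + 1) * L" by (rule eventually_gt_at_top)
  ultimately have "\<forall>\<^sub>F N in sequentially. norm (\<beta> N) < \<delta> \<and> N > M + (D + 1) * L"
    by eventually_elim simp
  then obtain N where N: "norm (\<beta> N) < \<delta>" "N > M + (D + 1) * L"
    by (auto simp: eventually_sequentially)
  define b where "b = \<beta> N"
  have b: "norm b \<le> 1" "norm b < e / 2" "norm b * (C * V * 3 ^ i + 1) < e"
    using N(1) C V by (auto simp: b_def \<delta>_def less_divide_eq add_nonneg_pos split: if_splits)

  \<comment> \<open>The perturbed vectors and their degrees\<close>
  define m where "m = n N"
  define k where "k = key * N"
  have m: "m = k + d" by (simp add: m_def k_def n_def)
  define z where "z = shift_unit ^ d * b"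
  have supp_b: "supp_le p b" by (simp add: b_def \<beta>_def supp_le_finseq)
  have z: "norm z \<le> norm b" "supp_le L z"
    unfolding z_def L_def
    by (auto intro: norm_shift_power_mult_le supp_le_mult supp_le_shift_power supp_b)
  define F where "F = shift_unit ^ ((D + 1) * N) * (of_real a + z)"
  define E where "E = shift_unit ^ N * of_real a"
  define x where "x = F + x0"
  define y where "y = E + y0"
  have sF: "supp_le ((D + 1) * N + L) F"
    unfolding F_def by (intro supp_le_mult supp_le_shift_power supp_le_add supp_le_of_real z)
  have sE: "supp_le N E"
    unfolding E_def using supp_le_mult[OF supp_le_shift_power supp_le_of_real[of 0 a], of N] by simp
  have sx: "supp_le ((D + 1) * N + L) x"
    unfolding x_def using N(2) by (intro supp_le_add sF supp_le_mono[OF x0]) auto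
  have sy: "supp_le N y"
    unfolding y_def using N(2) by (intro supp_le_add sE supp_le_mono[OF y0]) auto
  have iL: "i' * L \<le> D * L" if "i' \<le> D" for i' using that by simp
  have nx: "norm (x - x0) < e"
  proof -
    have "norm F \<le> norm (of_real a + z)" unfolding F_def by (rule norm_shift_power_mult_le)
    also have "\<dots> \<le> a + norm z" using norm_triangle_ineq[of "of_real a" z] a by simp
    also have "\<dots> < e" using z(1) b(2) a(3) by simp
    finally show ?thesis by (simp add: x_def)
  qed
  have ny: "norm (y - y0) < e"
    using norm_shift_power_mult_le[of N "of_real a"] a e by (simp add: y_def E_def)

  \<comment> \<open>Annihilation of everything of low degree\<close>
  have lower: "(T ^^ m) (x ^ i' * y ^ j') = 0"
    if ij': "i' \<le> D" "i' * (D + 1) + j' < key" for i' j'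
  proof (rule funpow_eq_0)
    show "supp_le (i' * ((D + 1) * N + L) + j' * N) (x ^ i' * y ^ j')"
      by (intro supp_le_mult supp_le_power sx sy)
    \<comment> \<open>A smaller key costs a full \<open>N\<close>, which outweighs the slack
      \<open>i' * L\<close>.\<close>
    have "(i' * (D + 1) + j' + 1) * N \<le> key * N" using ij'(2) by (intro mult_le_mono1) simp
    moreover have "(i' * (D + 1) + j' + 1) * N = (i' * (D + 1) + j') * N + N"
      and "(D + 1) * L = D * L + L" by simp_all
    moreover have "i' * ((D + 1) * N + L) + j' * N = (i' * (D + 1) + j') * N + i' * L"
      by (simp add: algebra_simps)
    ultimately show "i' * ((D + 1) * N + L) + j' * N < m"
      using iL[OF ij'(1)] N(2) unfolding m k_def by linarith
  qed
  have kk: "i * ((D + 1) * N + L) + j * N = k + i * L"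
    by (simp add: k_def key_def algebra_simps)
  \<comment> \<open>Exchanging one factor of degree bound \<open>A\<close> for one of degree bound
    \<open>M\<close> lowers the total \<open>k + i * L\<close> by more than \<open>D * L\<close>,
    hence below \<open>k\<close>.\<close>
  have gap: "P - (A - M) + J < m" if "A \<le> P" "P + J = k + i * L" "M + D * L < A" for P A J
    using that iL[OF i(2)] unfolding m d_def by linarith
  have 1: "(T ^^ m) ((x ^ i - F ^ i) * y ^ j) = 0"
  proof (rule funpow_eq_0)
    have "supp_le (M + ((D + 1) * N + L - M)) F" using sF N(2) by simp
    from supp_le_power_add_diff[OF x0 this, of i]
    have "supp_le (i * ((D + 1) * N + L) - ((D + 1) * N + L - M)) (x ^ i - F ^ i)"
      unfolding x_def using N(2) by simp
    then show "supp_le (i * ((D + 1) * N + L) - ((D + 1) * N + L - M) + j * N) ((x ^ i - F ^ i) * y ^ j)"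
      by (intro supp_le_mult supp_le_power sy)
    have "1 * ((D + 1) * N + L) \<le> i * ((D + 1) * N + L)" using i(1) by (rule mult_le_mono1)
    moreover have "M + D * L < (D + 1) * N + L" using N(2) by simp
    ultimately show "i * ((D + 1) * N + L) - ((D + 1) * N + L - M) + j * N < m"
      using kk by (intro gap) (simp_all only: mult_1)
  qed
  have 2: "(T ^^ m) (F ^ i * (y ^ j - E ^ j)) = 0"
  proof (cases "j = 0")
    case False
    show ?thesis
    proof (rule funpow_eq_0)
      have "supp_le (M + (N - M)) E" using sE N(2) by simp
      from supp_le_power_add_diff[OF y0 this, of j]
      have "supp_le (j * N - (N - M)) (y ^ j - E ^ j)"
        unfolding y_def using N(2) by simp
      then show "supp_le (i * ((D + 1) * N + L) + (j * N - (N - M))) (F ^ i * (y ^ j - E ^ j))"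
        by (intro supp_le_mult supp_le_power sF)
      have "1 * N \<le> j * N" using False by (intro mult_le_mono1) simp
      then show "i * ((D + 1) * N + L) + (j * N - (N - M)) < m"
        using kk iL[OF i(2)] N(2) add_mult_distrib[of D 1 L] unfolding m d_def by linarith
    qed
  qed simp

  \<comment> \<open>Linear and quadratic contributions to the leading monomial\<close>
  obtain R where R: "(of_real a + z) ^ i = of_real (a ^ i) + of_real (real i * a ^ (i - 1)) * z + z ^ 2 * R"
    and nR: "norm R \<le> 3 ^ i" and sR: "supp_le (i * L) R"
    using power_add_quadratic_remainder[of a z L i] a z b(1) by auto
  \<comment> \<open>\<open>z ^ 2\<close> contains the basis vector of index \<open>2 * d\<close>.
    One \<open>d\<close> completes \<open>k\<close> to \<open>m\<close>; the other stays in
    \<open>r\<close>, whose support thus starts at \<open>d\<close>, where the estimate for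
    \<open>\<beta>\<close> applies.\<close>
  define r where "r = shift_unit ^ d * (b ^ 2 * R * of_real (a ^ j))"
  have "F ^ i * E ^ j = (shift_unit ^ ((D + 1) * N)) ^ i * (shift_unit ^ N) ^ j
      * of_real (a ^ j) * (of_real a + z) ^ i"
    by (simp add: F_def E_def power_mult_distrib mult_ac)
  also have "(shift_unit ^ ((D + 1) * N)) ^ i * (shift_unit ^ N) ^ j = shift_unit ^ k"
    by (simp add: k_def key_def power_add power_mult[symmetric] algebra_simps)
  also have "shift_unit ^ k * of_real (a ^ j) * (of_real a + z) ^ i
      = shift_unit ^ k * of_real (a ^ i * a ^ j) + shift_unit ^ m * (of_real \<kappa> * b) + shift_unit ^ m * r"
    unfolding R by (simp add: m r_def z_def \<kappa>_def power_add power2_eq_square algebra_simps)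
  finally have FE: "F ^ i * E ^ j = \<dots>" .
  have 3: "(T ^^ m) (shift_unit ^ k * of_real (a ^ i * a ^ j)) = 0"
  proof (rule funpow_eq_0)
    show "supp_le (k + 0) (shift_unit ^ k * of_real (a ^ i * a ^ j))"
      by (intro supp_le_mult supp_le_shift_power supp_le_of_real)
    show "k + 0 < m" by (simp add: m d_def)
  qed
  have 4: "(T ^^ m) (shift_unit ^ m * (of_real \<kappa> * b)) = t"
  proof (rule ell1_eqI)
    fix q
    have "seq (of_real \<kappa> * b) q = of_real \<kappa> * seq b q"
      by (metis scaleR_conv_of_real seq_scaleR)
    then show "seq ((T ^^ m) (shift_unit ^ m * (of_real \<kappa> * b))) q = seq t q"
      using \<kappa> by (simp add: seq_funpow_shift_mult t b_def \<beta>_def seq_finseq m_def add.commute)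
  qed
  have 5: "norm b * norm ((T ^^ m) (shift_unit ^ m * r)) \<le> C * V * norm r"
  proof (rule norm_funpow_shift_mult_le[OF _ V1 _ _ C V])
    have "supp_le (d + (2 * p + i * L + 0)) r"
      unfolding r_def by (intro supp_le_mult supp_le_shift_power supp_le_of_real supp_le_power supp_b sR)
    then show "supp_le Q r" by (simp add: Q_def)
    fix q assume q: "q \<le> Q" "seq r q \<noteq> 0"
    then have "d \<le> q" by (auto simp: r_def seq_shift_power_mult split: if_splits)
    then show "norm b * norm (v (q + m)) \<le> C"
      using \<beta>v[of q N] q(1) by (simp add: b_def m_def d_def)
  qed auto
  have nr: "norm r \<le> norm b ^ 2 * 3 ^ i"
  proof -
    have "norm r \<le> norm (b ^ 2 * R * of_real (a ^ j))"
      unfolding r_def by (rule norm_shift_power_mult_le)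
    also have "\<dots> \<le> norm (b ^ 2) * norm R * norm (of_real (a ^ j) :: ell1)"
      by (meson mult_right_mono norm_ge_zero norm_mult_ineq order_trans)
    also have "\<dots> \<le> norm b ^ 2 * 3 ^ i * 1"
      using nR a by (intro mult_mono norm_power_ineq) (auto simp: power_le_one simp del: of_real_power)
    finally show ?thesis by simp
  qed
  \<comment> \<open>One of the two factors \<open>norm b\<close> in the bound on \<open>r\<close> is
    spent on the growth of \<open>v\<close>, the other makes the error small.\<close>
  have "norm ((T ^^ m) (shift_unit ^ m * r)) \<le> norm b * (C * V * 3 ^ i)"
  proof (cases "b = 0")
    case True
    then show ?thesis by (simp add: r_def)
  next
    case False
    have "norm b * norm ((T ^^ m) (shift_unit ^ m * r)) \<le> C * V * (norm b ^ 2 * 3 ^ i)"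
      using 5 nr C V by (meson mult_left_mono mult_nonneg_nonneg order_trans)
    also have "\<dots> = norm b * (norm b * (C * V * 3 ^ i))"
      by (simp add: power2_eq_square)
    finally show ?thesis using False by simp
  qed
  also have "\<dots> \<le> norm b * (C * V * 3 ^ i + 1)"
    by (intro mult_left_mono) auto
  also have "\<dots> < e" by (rule b(3))
  finally have err: "norm ((T ^^ m) (shift_unit ^ m * r)) < e" .
  have "x ^ i * y ^ j = (x ^ i - F ^ i) * y ^ j + (F ^ i * (y ^ j - E ^ j) + F ^ i * E ^ j)"
    by (simp add: algebra_simps)
  then have "(T ^^ m) (x ^ i * y ^ j) = t + (T ^^ m) (shift_unit ^ m * r)"
    by (simp only: FE funpow_add 1 2 3 4 add_0)
  then have "norm ((T ^^ m) (x ^ i * y ^ j) - t) < e" using err by simp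
  with nx ny lower show ?thesis unfolding key_def by blast
qed

end

section \<open>Generic pairs\<close>

lemma zero_notin_HC:
  assumes "weighted_shift w T"
  shows "0 \<notin> HC T"
proof
  interpret weighted_shift w T by fact
  assume "0 \<in> HC T"
  then have "closure {0 :: ell1} = UNIV" by (simp add: HC_def)
  then have "(1 :: ell1) \<in> {0}" by (metis UNIV_I closed_singleton closure_closed)
  then show False by simp
qed

context weighted_shift
begin

text \<open>The conditions for a target in \<open>Q\<close> and a tolerance \<open>1 / Suc m\<close>
  are countably many. Each defines a set that is open by continuity of the iterates, and dense
  because truncated pairs are dense and can be perturbed.\<close>

lemma generic_pair:
  assumes v_lim: "filterlim (\<lambda>n. norm (v n)) at_top sequentially"
  obtains x y where "\<And>i j D t e. 1 \<le> i \<Longrightarrow> i \<le> D \<Longrightarrow> e > 0 \<Longrightarrow>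
    \<exists>n. norm ((T ^^ n) (x ^ i * y ^ j) - t) < e
      \<and> (\<forall>i'\<le>D. \<forall>j'\<le>D. i' * (D + 1) + j' < i * (D + 1) + j \<longrightarrow> norm ((T ^^ n) (x ^ i' * y ^ j')) < e)"
proof -
  obtain Q where Q: "countable Q" "\<And>t e. e > 0 \<Longrightarrow> \<exists>q\<in>Q. norm (q - t) < e"
    "\<And>q. q \<in> Q \<Longrightarrow> \<exists>N f. q = finseq N f"
    using countable_dense_finseq by metis
  \<comment> \<open>The bound on \<open>j'\<close> makes this index set finite, so the intersection
    in \<open>G\<close> remains open.\<close>
  define B where "B i j D = {(i', j'). i' \<le> D \<and> j' \<le> D \<and> i' * (D + 1) + j' < i * (D + 1) + j}"
    for i j D :: nat
  have finB: "finite (B i j D)" for i j D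
    by (rule finite_subset[of _ "{..D} \<times> {..D}"]) (auto simp: B_def)
  define G where "G = (\<lambda>(i, j, D, t, m). \<Union>n. {p. norm ((T ^^ n) (fst p ^ i * snd p ^ j) - t) < 1 / real (Suc m)}
    \<inter> (\<Inter>(i', j')\<in>B i j D. {p. norm ((T ^^ n) (fst p ^ i' * snd p ^ j')) < 1 / real (Suc m)}))"
  define I where "I = {(i :: nat, j :: nat, D, t, m :: nat). 1 \<le> i \<and> i \<le> D \<and> t \<in> Q}"
  have cont: "continuous_on UNIV (\<lambda>p. (T ^^ n) (fst p ^ i * snd p ^ j))" for n i j
    by (rule continuous_on_compose2[OF continuous_funpow]) (auto intro!: continuous_intros)
  have open_G: "open (G u)" for u
    unfolding G_def
    by (cases u) (auto intro!: open_Int open_INT finB open_Collect_less continuous_intros cont)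
  have dense_G: "closure (G u) = UNIV" if "u \<in> I" for u
  proof -
    obtain i j D t m where u: "u = (i, j, D, t, m)" by (cases u)
    with that have u': "1 \<le> i" "i \<le> D" "t \<in> Q" by (auto simp: I_def)
    obtain p h where t: "t = finseq p h" using Q(3) u'(3) by blast
    have "\<exists>z\<in>G u. dist z (x, y) < r" if r: "r > 0" for x y r
    proof -
      have "\<forall>\<^sub>F N in sequentially. dist (finseq N (seq x)) x < r / 4 \<and> dist (finseq N (seq y)) y < r / 4"
        using finseq_truncation_tendsto r by (intro eventually_conj tendstoD) auto
      then obtain N where N: "dist (finseq N (seq x)) x < r / 4" "dist (finseq N (seq y)) y < r / 4"
        by (auto simp: eventually_sequentially)
      define e where "e = min (r / 4) (1 / real (Suc m))"
      have e: "e > 0" "e \<le> r / 4" "e \<le> 1 / real (Suc m)" using r by (auto simp: e_def)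
      obtain x' y' n where *: "norm (x' - finseq N (seq x)) < e" "norm (y' - finseq N (seq y)) < e"
        "norm ((T ^^ n) (x' ^ i * y' ^ j) - t) < e"
        "\<And>i' j'. i' \<le> D \<Longrightarrow> i' * (D + 1) + j' < i * (D + 1) + j \<Longrightarrow> (T ^^ n) (x' ^ i' * y' ^ j') = 0"
        using perturbation_hits_target[OF v_lim u'(1,2) e(1)
            supp_le_finseq[OF le_SucI[OF order_refl]] supp_le_finseq[OF le_SucI[OF order_refl]] t, of N "seq x" "seq y" j]
        by blast
      have "(x', y') \<in> G u"
        unfolding G_def u B_def using *(3,4) e by (auto intro!: exI[of _ n])
      moreover have "dist x' x < r / 2" "dist y' y < r / 2"
        using *(1,2) N e dist_triangle[of x' x "finseq N (seq x)"] dist_triangle[of y' y "finseq N (seq y)"]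
        by (auto simp: dist_norm)
      then have "dist (x', y') (x, y) < r"
        unfolding dist_prod_def using sqrt_sum_squares_le_sum_abs[of "dist x' x" "dist y' y"] by simp
      ultimately show ?thesis by blast
    qed
    then show ?thesis by (auto simp: closure_approachable)
  qed
  have "euclidean closure_of \<Inter> (G ` I) = topspace (euclidean :: (ell1 \<times> ell1) topology)"
  proof (rule Baire_category)
    show "completely_metrizable_space (euclidean :: (ell1 \<times> ell1) topology)
        \<or> locally_compact_space (euclidean :: (ell1 \<times> ell1) topology) \<and> regular_space (euclidean :: (ell1 \<times> ell1) topology)"
      using completely_metrizable_space_euclidean by blast
    have "countable (UNIV \<times> UNIV \<times> UNIV \<times> Q \<times> UNIV :: (nat \<times> nat \<times> nat \<times> ell1 \<times> nat) set)"
      using Q(1) by auto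
    then have "countable I" by (rule countable_subset[rotated]) (auto simp: I_def)
    then show "countable (G ` I)" by simp
  qed (use open_G dense_G in auto)
  then have "\<Inter> (G ` I) \<noteq> {}" by (metis UNIV_not_empty closure_of_empty topspace_euclidean)
  then obtain x y where xy: "\<And>u. u \<in> I \<Longrightarrow> (x, y) \<in> G u" by auto
  show ?thesis
  proof (rule that)
    fix i j D :: nat and t and e :: real
    assume *: "1 \<le> i" "i \<le> D" "e > 0"
    obtain q where q: "q \<in> Q" "norm (q - t) < e / 2" using Q(2)[of "e / 2" t] *(3) by auto
    obtain m where m: "1 / real (Suc m) < e / 2"
      using reals_Archimedean[of "e / 2"] *(3) by (auto simp: inverse_eq_divide)
    have "(i, j, D, q, m) \<in> I" using * q by (simp add: I_def)
    from xy[OF this] obtain n where n: "norm ((T ^^ n) (x ^ i * y ^ j) - q) < 1 / real (Suc m)"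
      "\<And>i' j'. (i', j') \<in> B i j D \<Longrightarrow> norm ((T ^^ n) (x ^ i' * y ^ j')) < 1 / real (Suc m)"
      unfolding G_def by fastforce
    have "norm ((T ^^ n) (x ^ i * y ^ j) - t) < e"
      using n(1) m q(2) norm_triangle_ineq[of "(T ^^ n) (x ^ i * y ^ j) - q" "q - t"] by simp
    moreover have "norm ((T ^^ n) (x ^ i' * y ^ j')) < e"
      if "i' \<le> D" "j' \<le> D" "i' * (D + 1) + j' < i * (D + 1) + j" for i' j'
      using n(2)[of i' j'] that m *(3) by (simp add: B_def)
    ultimately show "\<exists>n. norm ((T ^^ n) (x ^ i * y ^ j) - t) < e
      \<and> (\<forall>i'\<le>D. \<forall>j'\<le>D. i' * (D + 1) + j' < i * (D + 1) + j \<longrightarrow> norm ((T ^^ n) (x ^ i' * y ^ j')) < e)"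
      by blast
  qed
qed

text \<open>Aim the monomial with the largest key at the target divided by its coefficient; all
  others become small at the same time.\<close>

lemma hypercyclic_pair:
  assumes v_lim: "filterlim (\<lambda>n. norm (v n)) at_top sequentially"
  obtains x y where "\<And>F c. finite F \<Longrightarrow> F \<noteq> {} \<Longrightarrow> \<forall>p\<in>F. 1 \<le> fst p \<and> c p \<noteq> 0 \<Longrightarrow>
    (\<Sum>p\<in>F. c p *\<^sub>C (x ^ fst p * y ^ snd p)) \<in> HC T"
proof -
  obtain x y where xy: "\<And>i j D t e. 1 \<le> i \<Longrightarrow> i \<le> D \<Longrightarrow> e > 0 \<Longrightarrow>
    \<exists>n. norm ((T ^^ n) (x ^ i * y ^ j) - t) < e
      \<and> (\<forall>i'\<le>D. \<forall>j'\<le>D. i' * (D + 1) + j' < i * (D + 1) + j \<longrightarrow> norm ((T ^^ n) (x ^ i' * y ^ j')) < e)"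
    using generic_pair[OF v_lim] by blast
  show ?thesis
  proof (rule that)
    fix F :: "(nat \<times> nat) set" and c :: "nat \<times> nat \<Rightarrow> complex"
    assume F: "finite F" "F \<noteq> {}" and c: "\<forall>p\<in>F. 1 \<le> fst p \<and> c p \<noteq> 0"
    define mon where "mon p = x ^ fst p * y ^ snd p" for p :: "nat \<times> nat"
    define D where "D = Max (fst ` F \<union> snd ` F)"
    have D: "fst p \<le> D" "snd p \<le> D" if "p \<in> F" for p
      using F that by (auto simp: D_def)
    define key where "key p = fst p * (D + 1) + snd p" for p :: "nat \<times> nat"
    \<comment> \<open>Both exponents are at most \<open>D\<close>, so \<open>div\<close> and
      \<open>mod\<close> by \<open>D + 1\<close> recover them from the key.\<close>
    have inj: "p = q" if "p \<in> F" "q \<in> F" "key p = key q" for p q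
    proof -
      have "fst u = key u div (D + 1) \<and> snd u = key u mod (D + 1)" if "u \<in> F" for u
        using D(2)[OF that] by (simp add: key_def del: mult_Suc_right)
      then show ?thesis using that by (metis prod_eqI)
    qed
    have "Max (key ` F) \<in> key ` F" using F by (intro Max_in) auto
    then obtain \<alpha> where \<alpha>: "\<alpha> \<in> F" "key \<alpha> = Max (key ` F)" by auto
    have less: "key p < key \<alpha>" if "p \<in> F - {\<alpha>}" for p
      using that inj[of p \<alpha>] \<alpha> F(1) by (metis Diff_iff Max_ge finite_imageI imageI insertI1 le_neq_implies_less)
    define P where "P = (\<Sum>p\<in>F. c p *\<^sub>C mon p)"
    have "\<exists>n. norm ((T ^^ n) P - t) < e" if e: "e > 0" for t e
    proof -
      define s where "s = (\<Sum>p\<in>F. norm (c p))"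
      have s: "s \<ge> 0" by (simp add: s_def sum_nonneg)
      define e' where "e' = e / (s + 1)"
      have e': "e' > 0" "s * e' < e"
        using e s by (auto simp: e'_def divide_simps)
      define t' where "t' = inverse (c \<alpha>) *\<^sub>C t"
      obtain n where n: "norm ((T ^^ n) (mon \<alpha>) - t') < e'"
        "\<And>p. p \<in> F - {\<alpha>} \<Longrightarrow> norm ((T ^^ n) (mon p)) < e'"
        using xy[of "fst \<alpha>" D e' "snd \<alpha>" t'] c \<alpha>(1) D e'(1) less
        unfolding mon_def key_def by blast
      have t: "c \<alpha> *\<^sub>C t' = t" using c \<alpha>(1) by (simp add: t'_def)
      have "(T ^^ n) P = (\<Sum>p\<in>F. c p *\<^sub>C (T ^^ n) (mon p))"
        by (simp add: P_def funpow_sum funpow_scaleC)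
      also have "\<dots> = c \<alpha> *\<^sub>C (T ^^ n) (mon \<alpha>) + (\<Sum>p\<in>F - {\<alpha>}. c p *\<^sub>C (T ^^ n) (mon p))"
        using F(1) \<alpha>(1) by (rule sum.remove)
      finally have "(T ^^ n) P - t = c \<alpha> *\<^sub>C ((T ^^ n) (mon \<alpha>) - t') + (\<Sum>p\<in>F - {\<alpha>}. c p *\<^sub>C (T ^^ n) (mon p))"
        by (simp add: ell1.scale_right_diff_distrib t)
      then have "norm ((T ^^ n) P - t)
          \<le> norm (c \<alpha> *\<^sub>C ((T ^^ n) (mon \<alpha>) - t')) + norm (\<Sum>p\<in>F - {\<alpha>}. c p *\<^sub>C (T ^^ n) (mon p))"
        by (simp add: norm_triangle_ineq)
      also have "\<dots> \<le> norm (c \<alpha>) * e' + (\<Sum>p\<in>F - {\<alpha>}. norm (c p) * e')"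
        using n by (intro add_mono order_trans[OF norm_sum] sum_mono)
          (simp_all add: norm_scaleC mult_left_mono less_imp_le)
      also have "\<dots> = (\<Sum>p\<in>F. norm (c p) * e')"
        using sum.remove[OF F(1) \<alpha>(1), of "\<lambda>p. norm (c p) * e'"] by simp
      also have "\<dots> = s * e'" by (simp add: s_def sum_distrib_right)
      finally show ?thesis using e'(2) by (intro exI[of _ n]) simp
    qed
    then have "P \<in> HC T" by (auto simp: HC_def closure_approachable dist_norm)
    then show "(\<Sum>p\<in>F. c p *\<^sub>C (x ^ fst p * y ^ snd p)) \<in> HC T" by (simp add: P_def mon_def)
  qed
qed

end

section \<open>An infinitely generated algebra\<close>

text \<open>Since \<open>f\<close> need not be injective, one preimage is chosen for each vector
  that occurs; this allows sums indexed by exponents.\<close>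

lemma span_image_combination:
  assumes "u \<in> ell1.span (f ` K)"
  obtains F c where "finite F" "F \<subseteq> K" "\<forall>p\<in>F. c p \<noteq> 0" "u = (\<Sum>p\<in>F. c p *\<^sub>C f p)"
proof -
  obtain g where u: "u = (\<Sum>a | g a \<noteq> 0. g a *\<^sub>C a)" and g: "finite {a. g a \<noteq> 0}" "{a. g a \<noteq> 0} \<subseteq> f ` K"
    using assms unfolding ell1.span_explicit' by auto
  obtain F where F: "F \<subseteq> K" "inj_on f F" "{a. g a \<noteq> 0} = f ` F"
    using g(2) unfolding subset_image_inj by blast
  show ?thesis
  proof (rule that[of F "g \<circ> f"])
    show "finite F" using g(1) F by (simp add: finite_image_iff)
    show "F \<subseteq> K" "\<forall>p\<in>F. (g \<circ> f) p \<noteq> 0" using F by auto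
    show "u = (\<Sum>p\<in>F. (g \<circ> f) p *\<^sub>C f p)"
      unfolding u F(3) using F(2) by (simp add: sum.reindex)
  qed
qed

text \<open>Bilinearity extends closure under products from \<open>S\<close> to its span, one factor
  at a time.\<close>

lemma subalgebra_span:
  assumes "\<And>a b. a \<in> S \<Longrightarrow> b \<in> S \<Longrightarrow> a * b \<in> ell1.span S"
  shows "subalgebra (ell1.span S)"
  unfolding subalgebra_def
proof (intro conjI ballI)
  show "ell1.subspace (ell1.span S)" by (rule ell1.subspace_span)
  fix u v assume u: "u \<in> ell1.span S" and v: "v \<in> ell1.span S"
  have 1: "a * v \<in> ell1.span S" if "a \<in> S" for a
    using v
  proof (induction rule: ell1.span_induct_alt)
    case (step c b z)
    then show ?case
      using assms[OF that] by (simp add: distrib_left scaleC_mult_right ell1.span_add ell1.span_scale)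
  qed (simp add: ell1.span_zero)
  show "u * v \<in> ell1.span S"
    using u
  proof (induction rule: ell1.span_induct_alt)
    case (step c a z)
    then show ?case
      using 1 by (simp add: distrib_right scaleC_mult_left ell1.span_add ell1.span_scale)
  qed (simp add: ell1.span_zero)
qed

text \<open>
  The polynomials in \<open>x\<close> and \<open>y\<close> divisible by \<open>x\<close> form an algebra generated by the \<open>x * y ^ j\<close>.
  It is not finitely generated, because finitely many generators involve only finitely many
  \<open>x * y ^ j\<close>, and products do not contribute to the part of degree 1 in \<open>x\<close>.
\<close>

lemma algebrable_if_combinations:
  assumes comb: "\<And>F c. finite F \<Longrightarrow> F \<noteq> {} \<Longrightarrow> \<forall>p\<in>F. 1 \<le> fst p \<and> c p \<noteq> 0 \<Longrightarrow>
      (\<Sum>p\<in>F. c p *\<^sub>C (x ^ fst p * y ^ snd p)) \<in> M"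
    and M: "0 \<notin> M"
  shows "algebrable M"
proof -
  define mon where "mon p = x ^ fst p * y ^ snd p" for p :: "nat \<times> nat"
  have mon_mult: "mon p * mon q = mon (fst p + fst q, snd p + snd q)" for p q
    by (simp add: mon_def power_add mult_ac)
  \<comment> \<open>Linear independence of the monomials comes for free: a vanishing combination
    would put 0 into \<open>M\<close>.\<close>
  have indep: False if "finite F" "F \<noteq> {}" "\<forall>p\<in>F. 1 \<le> fst p \<and> c p \<noteq> 0" "(\<Sum>p\<in>F. c p *\<^sub>C mon p) = 0" for F c
    using comb[OF that(1-3)] that(4) M by (simp add: mon_def)
  define K where "K = {p :: nat \<times> nat. 1 \<le> fst p}"
  define A where "A = ell1.span (mon ` K)"
  define K' where "K' J = {p :: nat \<times> nat. 1 \<le> fst p \<and> (fst p = 1 \<longrightarrow> snd p \<le> J)}" for J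
  have subA: "subalgebra A"
    unfolding A_def by (rule subalgebra_span) (auto simp: mon_mult K_def intro!: ell1.span_base)
  \<comment> \<open>A product has degree at least 2 in \<open>x\<close>, where \<open>K'\<close>
    puts no restriction on the exponent of \<open>y\<close>.\<close>
  have subK': "subalgebra (ell1.span (mon ` K' J))" for J
    by (rule subalgebra_span) (auto simp: mon_mult K'_def intro!: ell1.span_base)
  have AM: "A \<subseteq> M \<union> {0}"
  proof
    fix u assume "u \<in> A"
    then obtain F c where F: "finite F" "F \<subseteq> K" "\<forall>p\<in>F. c p \<noteq> 0" "u = (\<Sum>p\<in>F. c p *\<^sub>C mon p)"
      unfolding A_def by (rule span_image_combination)
    show "u \<in> M \<union> {0}"
      using comb[of F c] F by (cases "F = {}") (auto simp: K_def mon_def)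
  qed
  define S0 where "S0 = range (\<lambda>j. mon (1, j))"
  have "inj (\<lambda>j. mon (1, j))"
  proof (rule injI, rule ccontr)
    fix j l assume jl: "mon (1, j) = mon (1, l)" "j \<noteq> l"
    show False
      using jl by (intro indep[of "{(1, j), (1, l)}" "\<lambda>p. if p = (1, j) then 1 else - 1"]) auto
  qed
  then have infS0: "infinite S0" unfolding S0_def by (rule range_inj_infinite)
  have hullS0: "subalgebra hull S0 = A"
  proof (rule hull_unique)
    show "subalgebra A" by (rule subA)
    show "S0 \<subseteq> A" unfolding S0_def A_def K_def by (auto intro!: ell1.span_base)
    fix A' assume A': "S0 \<subseteq> A'" "subalgebra A'"
    have "mon (Suc i, j) \<in> A'" for i j
    proof (induction i)
      case 0
      then show ?case using A'(1) by (auto simp: S0_def)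
    next
      case (Suc i)
      have "mon (Suc (Suc i), j) = mon (1, 0) * mon (Suc i, j)" by (simp add: mon_mult)
      moreover have "mon (1, 0) \<in> A'" using A'(1) by (auto simp: S0_def)
      ultimately show ?case using Suc A'(2) by (simp add: subalgebra_def)
    qed
    then have "mon ` K \<subseteq> A'"
      by (auto simp: K_def) (metis Suc_diff_1 less_le_trans zero_less_one One_nat_def Suc_le_eq)
    then show "A \<subseteq> A'"
      unfolding A_def using A'(2) by (intro ell1.span_minimal) (auto simp: subalgebra_def)
  qed
  have "\<not> (\<exists>S. finite S \<and> A = subalgebra hull S)"
  proof
    assume "\<exists>S. finite S \<and> A = subalgebra hull S"
    then obtain S where S: "finite S" "A = subalgebra hull S" by blast
    have "\<exists>J. u \<in> ell1.span (mon ` K' J)" if "u \<in> S" for u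
    proof -
      have "u \<in> A" using that S(2) hull_subset by fast
      then obtain F c where F: "finite F" "F \<subseteq> K" "u = (\<Sum>p\<in>F. c p *\<^sub>C mon p)"
        unfolding A_def by (rule span_image_combination)
      have "snd p \<le> sum snd F" if "p \<in> F" for p using F(1) that by (intro member_le_sum) auto
      then have "F \<subseteq> K' (sum snd F)" using F(2) by (auto simp: K_def K'_def)
      then have "u \<in> ell1.span (mon ` K' (sum snd F))"
        unfolding F(3) by (intro ell1.span_sum ell1.span_scale ell1.span_base) auto
      then show ?thesis by blast
    qed
    then obtain J where J: "\<And>u. u \<in> S \<Longrightarrow> u \<in> ell1.span (mon ` K' (J u))" by metis
    define m where "m = sum J S"
    have "u \<in> ell1.span (mon ` K' m)" if "u \<in> S" for u
    proof -
      have "J u \<le> m" unfolding m_def using S(1) that by (intro member_le_sum) auto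
      then have "K' (J u) \<subseteq> K' m" by (auto simp: K'_def)
      then show ?thesis using J[OF that] ell1.span_mono[OF image_mono] by fast
    qed
    then have "A \<subseteq> ell1.span (mon ` K' m)"
      unfolding S(2) by (intro hull_minimal subK') auto
    moreover have "mon (1, Suc m) \<in> A" unfolding A_def K_def by (auto intro!: ell1.span_base)
    ultimately have "mon (1, Suc m) \<in> ell1.span (mon ` K' m)" by blast
    then obtain F c where F: "finite F" "F \<subseteq> K' m" "\<forall>p\<in>F. c p \<noteq> 0"
      "mon (1, Suc m) = (\<Sum>p\<in>F. c p *\<^sub>C mon p)"
      by (rule span_image_combination)
    have notin: "(1, Suc m) \<notin> F" using F(2) by (auto simp: K'_def)
    \<comment> \<open>Moves \<open>mon (1, Suc m)\<close> to the other side, giving a vanishing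
      combination with nonzero coefficients.\<close>
    define c' where "c' = c((1, Suc m) := - 1)"
    have "(\<Sum>p\<in>F. c' p *\<^sub>C mon p) = mon (1, Suc m)"
      unfolding F(4) using notin by (intro sum.cong) (auto simp: c'_def)
    then have zero: "(\<Sum>p\<in>insert (1, Suc m) F. c' p *\<^sub>C mon p) = 0"
      using F(1) notin by (simp add: c'_def)
    show False
      by (rule indep[OF _ _ _ zero]) (use F(1-3) in \<open>auto simp: K'_def c'_def\<close>)
  qed
  with subA AM infS0 hullS0 show ?thesis unfolding algebrable_def by blast
qed

lemma algebrable_HC:
  assumes "weighted_backward_shift w T" "mixing T"
  shows "algebrable (HC T)"
proof -
  interpret weighted_shift w T by standard (rule assms)
  obtain x y where "\<And>F c. finite F \<Longrightarrow> F \<noteq> {} \<Longrightarrow> \<forall>p\<in>F. 1 \<le> fst p \<and> c p \<noteq> 0 \<Longrightarrow>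
      (\<Sum>p\<in>F. c p *\<^sub>C (x ^ fst p * y ^ snd p)) \<in> HC T"
    using hypercyclic_pair[OF v_at_top[OF assms(2)]] by blast
  then show ?thesis
    using zero_notin_HC[OF weighted_shift_axioms] by (rule algebrable_if_combinations)
qed

theorem corollary3p7:
  shows "(\<forall>w T. weighted_backward_shift w T \<and> mixing T \<longrightarrow> algebrable (HC T)) \<and>
    (\<forall>c::complex. norm c > 1 \<longrightarrow>
       weighted_backward_shift (\<lambda>n. if n = 0 then 1 else c) (\<lambda>x. c *\<^sub>C backward_shift x) \<and>
       mixing (\<lambda>x. c *\<^sub>C backward_shift x) \<and>
       algebrable (HC (\<lambda>x. c *\<^sub>C backward_shift x)))"
proof -
  have "weighted_backward_shift (\<lambda>n. if n = 0 then 1 else c) (\<lambda>x. c *\<^sub>C backward_shift x)"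
    if "norm c > 1" for c
    using that by (intro weighted_backward_shift_Rolewicz) auto
  then show ?thesis using algebrable_HC mixing_Rolewicz by blast
qed

end
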